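(* The censorship of coherence $(\mathcal{F},\mathcal{CO}_{\mathrm{IO}})$ is breakable by account sharing. That is: let $d\ge2$, $N\ge1$, $\epsilon\in[0,1)$, and $\Omega(\rho)=\epsilon\rho+(1-\epsilon)\Delta(\rho)$ on $\mathbb{C}^d$ with $\Delta(\rho)=\sum_a|a\rangle\langle a|\rho|a\rangle\langle a|$. Then there exist a state $\rho\notin\mathcal{F}(A_1\dots A_N)$, independent parties $C_1,\dots,C_M$, a state $\omega_C$ of $C_1\dots C_M$, and an incoherent operation $\Lambda\in\mathcal{O}_{\mathrm{IO}}(B_1\dots B_NC_1\dots C_M)$ such that $$\mathrm{Tr}_{C_1\dots C_M}\{\Lambda(\Omega^{\otimes N}(\rho)\otimes\omega_C)\}=\rho.$$
   Context: Resource theory of coherence: each sender system $A_i$ and receiver system $B_i$ has Hilbert space $\mathbb{C}^d$ with fixed incoherent orthonormal basis $\{|a\rangle\}_{a=0}^{d-1}$ ($A_i$ and $B_i$ are identified), and every independent party $C_j$ has a finite-dimensional Hilbert space with its own fixed incoherent orthonormal basis. For a composite system the incoherent basis is the product basis. $\mathcal{F}$ is the set of density operators diagonal in the incoherent basis. $\mathcal{O}_{\mathrm{IO}}$ (of a composite system to itself, with incoherent basis $\{|b\rangle\}_{b\in I}$) is the set of channels $\Lambda(\rho)=\sum_aM_a\rho M_a^\dagger$, $\sum_aM_a^\dagger M_a=\mathbb{1}$, with $M_a=\sum_{b\in I}c_{ab}|f_a(b)\rangle\langle b|$, $c_{ab}\in\mathbb{C}$, $f_a:I\to I$. $\mathcal{CO}_{\mathrm{IO}}$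 denotes the catalytic transformations $\gamma\mapsto\mathrm{Tr}_{C_1\dots C_M}\{\Lambda(\gamma\otimes\omega_C)\}$ with $\Lambda\in\mathcal{O}_{\mathrm{IO}}(B_1\dots B_NC_1\dots C_M)$ and $\omega_C$ an arbitrary (not necessarily free) state of the uncensored independent parties; the catalyst need not be returned. Censorship is breakable by account sharing if some $\rho\notin\mathcal{F}(A_1\dots A_N)$ can be recovered from $\Omega^{\otimes N}(\rho)$ by such a catalytic transformation. *)

theory Defs
  imports "Jordan_Normal_Form.Schur_Decomposition"
begin

text \<open>
  An operator on an \<open>n\<close>-dimensional system is a matrix in \<^term>\<open>carrier_mat n n :: complex mat set\<close>;
  its fixed incoherent basis is the standard basis, indexed by \<open>0, \<dots>, n - 1\<close>.
  A composite of systems of dimensions \<open>m\<close> and \<open>n\<close> has dimension \<open>m * n\<close>, the product basis vector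
  \<open>|i\<rangle> \<otimes> |k\<rangle>\<close> having index \<open>i * n + k\<close> (see \<open>kron_ketbra\<close> below). So the product basis of
  \<open>B\<^sub>1 \<dots> B\<^sub>N C\<^sub>1 \<dots> C\<^sub>M\<close> is the standard basis of dimension \<open>d ^ N * prod_list [dim C\<^sub>1, \<dots>, dim C\<^sub>M]\<close>.
\<close>

definition ketbra :: "nat \<Rightarrow> nat \<Rightarrow> nat \<Rightarrow> complex mat" where
  "ketbra n i j = mat n n (\<lambda>(r, s). if r = i \<and> s = j then 1 else 0)"

text \<open>
  Matrices of unspecified dimension form no additive monoid with zero, so \<^const>\<open>sum\<close> does not apply
  to them; this is the sum of a family of \<open>n \<times> n\<close> matrices.
\<close>

definition op_sum :: "nat \<Rightarrow> ('i \<Rightarrow> complex mat) \<Rightarrow> 'i set \<Rightarrow> complex mat" where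
  "op_sum n F I = mat n n (\<lambda>(r, s). \<Sum>a\<in>I. F a $$ (r, s))"

definition op_trace :: "complex mat \<Rightarrow> complex" where
  "op_trace A = (\<Sum>i<dim_row A. A $$ (i, i))"

definition kron :: "complex mat \<Rightarrow> complex mat \<Rightarrow> complex mat" where
  "kron A B = mat (dim_row A * dim_row B) (dim_col A * dim_col B)
     (\<lambda>(r, s). A $$ (r div dim_row B, s div dim_col B) * B $$ (r mod dim_row B, s mod dim_col B))"

lemma kron_ketbra:
  assumes "i < m" "j < m" "k < n" "l < n"
  shows "kron (ketbra m i j) (ketbra n k l) = ketbra (m * n) (i * n + k) (j * n + l)"
proof -
  have *: "(r div n = i \<and> r mod n = k) \<longleftrightarrow> r = i * n + k" if "k < n" for r i k :: nat
    using that by (metis add.commute add_cancel_right_left div_mult_self3 div_less div_mult_mod_eq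
        mod_less mod_mult_self1 not_less_zero)
  show ?thesis
  proof (rule eq_matI)
    fix r s assume "r < dim_row (ketbra (m * n) (i * n + k) (j * n + l))"
      "s < dim_col (ketbra (m * n) (i * n + k) (j * n + l))"
    hence rs: "r < m * n" "s < m * n" by (auto simp: ketbra_def)
    have n: "0 < n" using assms by simp
    have "r div n < m" "s div n < m" "r mod n < n" "s mod n < n"
      using rs n by (auto simp: less_mult_imp_div_less)
    thus "kron (ketbra m i j) (ketbra n k l) $$ (r, s)
        = ketbra (m * n) (i * n + k) (j * n + l) $$ (r, s)"
      using rs *[OF assms(3), of r i] *[OF assms(4), of s j] by (auto simp: kron_def ketbra_def)
  qed (auto simp: kron_def ketbra_def)
qed

definition ptrace_right :: "nat \<Rightarrow> nat \<Rightarrow> complex mat \<Rightarrow> complex mat" where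
  "ptrace_right m n X = mat m m (\<lambda>(i, j). \<Sum>k<n. X $$ (i * n + k, j * n + k))"

text \<open>
  For linear \<open>\<Phi>\<close> and \<open>\<Psi>\<close> acting on \<open>m \<times> m\<close> and \<open>n \<times> n\<close> matrices, the linear map
  \<open>\<Phi> \<otimes> \<Psi>\<close> is determined by its values \<open>\<Phi>(|i\<rangle>\<langle>j|) \<otimes> \<Psi>(|k\<rangle>\<langle>l|)\<close> on products of matrix units.
\<close>

definition tensor_map ::
  "nat \<Rightarrow> (complex mat \<Rightarrow> complex mat) \<Rightarrow> nat \<Rightarrow> (complex mat \<Rightarrow> complex mat) \<Rightarrow> complex mat \<Rightarrow> complex mat"
where
  "tensor_map m \<Phi> n \<Psi> X = op_sum (m * n)
     (\<lambda>(i, j, k, l). X $$ (i * n + k, j * n + l) \<cdot>\<^sub>m kron (\<Phi> (ketbra m i j)) (\<Psi> (ketbra n k l)))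
     ({..<m} \<times> {..<m} \<times> {..<n} \<times> {..<n})"

primrec tensor_power ::
  "nat \<Rightarrow> (complex mat \<Rightarrow> complex mat) \<Rightarrow> nat \<Rightarrow> complex mat \<Rightarrow> complex mat"
where
  "tensor_power d \<Phi> 0 = (\<lambda>X. X)"
| "tensor_power d \<Phi> (Suc N) = tensor_map d \<Phi> (d ^ N) (tensor_power d \<Phi> N)"

text \<open>The order on \<^typ>\<open>complex\<close> is the partial one: \<open>0 \<le> z\<close> means that \<open>z\<close> is real and nonnegative.\<close>

definition positive_semidefinite :: "nat \<Rightarrow> complex mat \<Rightarrow> bool" where
  "positive_semidefinite n A \<longleftrightarrow>
     A \<in> carrier_mat n n \<and> mat_adjoint A = A \<and> (\<forall>v\<in>carrier_vec n. 0 \<le> (A *\<^sub>v v) \<bullet>c v)"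

definition density_operator :: "nat \<Rightarrow> complex mat \<Rightarrow> bool" where
  "density_operator n \<rho> \<longleftrightarrow> positive_semidefinite n \<rho> \<and> op_trace \<rho> = 1"

definition free_states :: "nat \<Rightarrow> complex mat set" where
  "free_states n = {\<rho>. density_operator n \<rho> \<and> diagonal_mat \<rho>}"

definition incoherent_kraus :: "nat \<Rightarrow> complex mat \<Rightarrow> bool" where
  "incoherent_kraus n M \<longleftrightarrow>
     (\<exists>c f. f \<in> {..<n} \<rightarrow> {..<n} \<and> M = op_sum n (\<lambda>b. c b \<cdot>\<^sub>m ketbra n (f b) b) {..<n})"

definition incoherent_operations :: "nat \<Rightarrow> (complex mat \<Rightarrow> complex mat) set" where
  "incoherent_operations n =
     {\<Lambda>. \<exists>K :: nat. \<exists>M.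
        (\<forall>a<K. incoherent_kraus n (M a)) \<and>
        op_sum n (\<lambda>a. mat_adjoint (M a) * M a) {..<K} = 1\<^sub>m n \<and>
        (\<forall>\<rho>\<in>carrier_mat n n. \<Lambda> \<rho> = op_sum n (\<lambda>a. M a * \<rho> * mat_adjoint (M a)) {..<K})}"

definition dephasing :: "nat \<Rightarrow> complex mat \<Rightarrow> complex mat" where
  "dephasing d \<rho> = op_sum d (\<lambda>a. ketbra d a a * \<rho> * ketbra d a a) {..<d}"

definition censor :: "nat \<Rightarrow> real \<Rightarrow> complex mat \<Rightarrow> complex mat" where
  "censor d \<epsilon> \<rho> = complex_of_real \<epsilon> \<cdot>\<^sub>m \<rho> + complex_of_real (1 - \<epsilon>) \<cdot>\<^sub>m dephasing d \<rho>"

end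

theory Submission
  imports Defs
begin

text \<open>
  Since the catalyst need not be returned, a single party \<open>C\<close> can hold a copy of the coherent state
  \<open>\<rho>\<close> itself. The swap of \<open>B\<^sub>1 \<dots> B\<^sub>N\<close> with \<open>C\<close> permutes the product basis, so it is an incoherent
  unitary, and discarding \<open>C\<close> afterwards leaves \<open>\<rho>\<close> times the trace of the censored state, which
  is 1 because censorship preserves the trace. Any coherent \<open>\<rho>\<close> would do.
\<close>

section \<open>Entries of adjoints, sums and products\<close>

lemma mat_adjoint_carrier:
  "A \<in> carrier_mat n m \<Longrightarrow> mat_adjoint A \<in> carrier_mat m n"
  by (auto simp: mat_adjoint_def mat_of_rows_def)

lemma mat_adjoint_index:
  fixes A :: "complex mat"
  assumes "A \<in> carrier_mat n m" "i < m" "j < n"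
  shows "mat_adjoint A $$ (i, j) = cnj (A $$ (j, i))"
  using assms by (auto simp: mat_adjoint_def mat_of_rows_def)

text \<open>Kraus families are indexed by \<open>{..<K}\<close>; this is the case
  \<open>K = 1\<close> of a single Kraus operator.\<close>

lemma op_sum_single:
  "F 0 \<in> carrier_mat n n \<Longrightarrow> op_sum n F {..<1::nat} = F 0"
  by (auto simp: op_sum_def intro!: eq_matI)

lemma times_mat_index_sum:
  assumes "A \<in> carrier_mat n m" "B \<in> carrier_mat m p" "i < n" "j < p"
  shows "(A * B) $$ (i, j) = (\<Sum>k<m. A $$ (i, k) * B $$ (k, j))"
  using assms by (simp add: scalar_prod_def lessThan_atLeast0)

section \<open>Trace preservation\<close>

lemma ketbra_index:
  "r < n \<Longrightarrow> s < n \<Longrightarrow> ketbra n i j $$ (r, s) = (if r = i \<and> s = j then 1 else 0)"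
  by (simp add: ketbra_def)

lemma op_trace_ketbra:
  "i < n \<Longrightarrow> op_trace (ketbra n i j) = (if i = j then 1 else 0)"
  by (auto simp: op_trace_def ketbra_def)

lemma sum_lessThan_mult:
  fixes g :: "nat \<Rightarrow> 'a::comm_monoid_add"
  shows "(\<Sum>r<m * n. g r) = (\<Sum>i<m. \<Sum>k<n. g (i * n + k))"
proof -
  have "(\<Sum>r = i * n..<i * n + n. g r) = (\<Sum>k<n. g (i * n + k))" for i
    by (subst sum.atLeastLessThan_shift_0) (simp add: lessThan_atLeast0)
  thus ?thesis
    by (simp add: sum.nat_group[symmetric])
qed

lemma op_trace_kron:
  assumes "A \<in> carrier_mat m m" "B \<in> carrier_mat n n"
  shows "op_trace (kron A B) = op_trace A * op_trace B"
  using assms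
  by (auto simp: op_trace_def kron_def sum_lessThan_mult sum_product intro!: sum.cong)

lemma op_trace_op_sum:
  assumes "\<And>a. a \<in> I \<Longrightarrow> F a \<in> carrier_mat n n"
  shows "op_trace (op_sum n F I) = (\<Sum>a\<in>I. op_trace (F a))"
proof -
  have "op_trace (op_sum n F I) = (\<Sum>r<n. \<Sum>a\<in>I. F a $$ (r, r))"
    by (simp add: op_trace_def op_sum_def)
  also have "\<dots> = (\<Sum>a\<in>I. \<Sum>r<n. F a $$ (r, r))"
    by (rule sum.swap)
  also have "\<dots> = (\<Sum>a\<in>I. op_trace (F a))"
    using assms by (intro sum.cong) (force simp: op_trace_def)+
  finally show ?thesis .
qed

text \<open>Preservation of the dimension is included so that \<open>kron\<close> of two outputs has
  the size over which its trace is computed.\<close>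

definition trace_preserving :: "nat \<Rightarrow> (complex mat \<Rightarrow> complex mat) \<Rightarrow> bool" where
  "trace_preserving n \<Phi> \<longleftrightarrow>
     (\<forall>X\<in>carrier_mat n n. \<Phi> X \<in> carrier_mat n n \<and> op_trace (\<Phi> X) = op_trace X)"

text \<open>The trace is multiplicative under \<open>kron\<close>, and the images of the matrix
  units |i><j| and |k><l| have traces \<delta>_ij and \<delta>_kl. Expanding X in products of matrix
  units therefore leaves only its diagonal entries.\<close>

lemma trace_preserving_tensor_map:
  assumes \<Phi>: "trace_preserving m \<Phi>" and \<Psi>: "trace_preserving n \<Psi>"
  shows "trace_preserving (m * n) (tensor_map m \<Phi> n \<Psi>)"
  unfolding trace_preserving_def
proof (intro ballI conjI)
  fix X :: "complex mat" assume X: "X \<in> carrier_mat (m * n) (m * n)"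
  show "tensor_map m \<Phi> n \<Psi> X \<in> carrier_mat (m * n) (m * n)"
    by (simp add: tensor_map_def op_sum_def)
  have kb: "ketbra p i j \<in> carrier_mat p p" for p i j
    by (simp add: ketbra_def)
  let ?F = "\<lambda>(i, j, k, l).
    X $$ (i * n + k, j * n + l) \<cdot>\<^sub>m kron (\<Phi> (ketbra m i j)) (\<Psi> (ketbra n k l))"
  let ?I = "{..<m} \<times> {..<m} \<times> {..<n} \<times> {..<n}"
  have car: "\<Phi> (ketbra m i j) \<in> carrier_mat m m" "\<Psi> (ketbra n k l) \<in> carrier_mat n n" for i j k l
    using \<Phi> \<Psi> kb by (auto simp: trace_preserving_def)
  have kcar: "kron (\<Phi> (ketbra m i j)) (\<Psi> (ketbra n k l)) \<in> carrier_mat (m * n) (m * n)" for i j k l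
    using car(1)[of i j] car(2)[of k l] by (auto simp: kron_def)
  \<comment> \<open>Nesting the conditionals, with l = k inside j = i, lets the sums over l and then
    over j collapse by the delta rule.\<close>
  have tr: "op_trace (?F (i, j, k, l))
      = (if j = i then if l = k then X $$ (i * n + k, j * n + l) else 0 else 0)"
    if "i < m" "k < n" for i j k l
  proof -
    have "op_trace (?F (i, j, k, l))
        = X $$ (i * n + k, j * n + l) * op_trace (kron (\<Phi> (ketbra m i j)) (\<Psi> (ketbra n k l)))"
      using kcar[of i j k l] by (auto simp: op_trace_def sum_distrib_left)
    thus ?thesis
      using \<Phi> \<Psi> kb that op_trace_kron[OF car, of i j k l]
      by (auto simp: trace_preserving_def op_trace_ketbra)
  qed
  have "op_trace (tensor_map m \<Phi> n \<Psi> X) = (\<Sum>a\<in>?I. op_trace (?F a))"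
    unfolding tensor_map_def by (rule op_trace_op_sum) (use kcar in auto)
  also have "\<dots> = (\<Sum>i<m. \<Sum>j<m. \<Sum>k<n. \<Sum>l<n. op_trace (?F (i, j, k, l)))"
    by (simp add: sum.cartesian_product case_prod_unfold)
  also have "\<dots> = (\<Sum>i<m. \<Sum>j<m. \<Sum>k<n. \<Sum>l<n.
      if j = i then if l = k then X $$ (i * n + k, j * n + l) else 0 else 0)"
    by (intro sum.cong refl tr) auto
  also have "\<dots> = (\<Sum>i<m. \<Sum>j<m. if j = i then \<Sum>k<n. X $$ (i * n + k, i * n + k) else 0)"
    by (intro sum.cong refl) auto
  also have "\<dots> = op_trace X"
    using X by (simp add: op_trace_def sum_lessThan_mult)
  finally show "op_trace (tensor_map m \<Phi> n \<Psi> X) = op_trace X" .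
qed

lemma trace_preserving_tensor_power:
  "trace_preserving d \<Phi> \<Longrightarrow> trace_preserving (d ^ N) (tensor_power d \<Phi> N)"
proof (induction N)
  case 0
  show ?case by (simp add: trace_preserving_def)
next
  case (Suc N)
  thus ?case using trace_preserving_tensor_map by simp
qed

lemma ketbra_mult_mult_ketbra_index:
  assumes "X \<in> carrier_mat d d" "a < d" "r < d" "s < d"
  shows "(ketbra d a a * X * ketbra d a a) $$ (r, s) = (if r = a \<and> s = a then X $$ (a, a) else 0)"
proof -
  have K: "ketbra d a a \<in> carrier_mat d d"
    by (simp add: ketbra_def)
  have left: "(ketbra d a a * X) $$ (i, j) = (if i = a then X $$ (a, j) else 0)"
    if "i < d" "j < d" for i j
  proof -
    have "(ketbra d a a * X) $$ (i, j)
        = (\<Sum>k<d. if k = a then if i = a then X $$ (a, j) else 0 else 0)"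
      unfolding times_mat_index_sum[OF K assms(1) that]
      using that by (intro sum.cong) (auto simp: ketbra_def)
    thus ?thesis using assms(2) by simp
  qed
  have "(ketbra d a a * X * ketbra d a a) $$ (r, s)
      = (\<Sum>k<d. if k = a then if r = a \<and> s = a then X $$ (a, a) else 0 else 0)"
    unfolding times_mat_index_sum[OF mult_carrier_mat[OF K assms(1)] K assms(3,4)]
    using assms(3,4) by (intro sum.cong) (auto simp: left ketbra_index)
  thus ?thesis using assms(2) by simp
qed

text \<open>Dephasing fixes every diagonal entry, and the weights \<epsilon> and 1 - \<epsilon> add
  up to 1, so the whole diagonal is unchanged.\<close>

lemma trace_preserving_censor: "trace_preserving d (censor d \<epsilon>)"
  unfolding trace_preserving_def
proof (intro ballI conjI)
  fix X :: "complex mat" assume X: "X \<in> carrier_mat d d"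
  have D: "dephasing d X \<in> carrier_mat d d"
    by (simp add: dephasing_def op_sum_def)
  show "censor d \<epsilon> X \<in> carrier_mat d d"
    using X D by (simp add: censor_def)
  have "dephasing d X $$ (r, r) = X $$ (r, r)" if "r < d" for r
    using that X by (simp add: dephasing_def op_sum_def ketbra_mult_mult_ketbra_index)
  hence "censor d \<epsilon> X $$ (r, r) = X $$ (r, r)" if "r < d" for r
    using that X D by (simp add: censor_def algebra_simps)
  thus "op_trace (censor d \<epsilon> X) = op_trace X"
    using X D by (simp add: op_trace_def censor_def)
qed

section \<open>Basis permutations are incoherent\<close>

definition perm_op :: "nat \<Rightarrow> (nat \<Rightarrow> nat) \<Rightarrow> complex mat" where
  "perm_op n f = mat n n (\<lambda>(r, s). if r = f s then 1 else 0)"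

lemma perm_op_carrier [simp]: "perm_op n f \<in> carrier_mat n n"
  by (simp add: perm_op_def)

lemma perm_op_index:
  "r < n \<Longrightarrow> s < n \<Longrightarrow> perm_op n f $$ (r, s) = (if r = f s then 1 else 0)"
  by (simp add: perm_op_def)

text \<open>Column b is the basis vector |f b>, so the operator is the sum of all |f b><b| with
  every coefficient equal to 1.\<close>

lemma incoherent_kraus_perm_op:
  assumes "f \<in> {..<n} \<rightarrow> {..<n}"
  shows "incoherent_kraus n (perm_op n f)"
  unfolding incoherent_kraus_def
proof (intro exI conjI)
  show "perm_op n f = op_sum n (\<lambda>b. 1 \<cdot>\<^sub>m ketbra n (f b) b) {..<n}"
  proof (rule eq_matI)
    fix r s assume "r < dim_row (op_sum n (\<lambda>b. 1 \<cdot>\<^sub>m ketbra n (f b) b) {..<n})"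
      "s < dim_col (op_sum n (\<lambda>b. 1 \<cdot>\<^sub>m ketbra n (f b) b) {..<n})"
    hence rs: "r < n" "s < n" by (auto simp: op_sum_def)
    have "(\<Sum>b<n. (1 \<cdot>\<^sub>m ketbra n (f b) b) $$ (r, s))
        = (\<Sum>b<n. if b = s then if r = f b then 1 else 0 else 0)"
      using rs by (intro sum.cong) (auto simp: ketbra_def)
    thus "perm_op n f $$ (r, s) = op_sum n (\<lambda>b. 1 \<cdot>\<^sub>m ketbra n (f b) b) {..<n} $$ (r, s)"
      using rs by (simp add: perm_op_def op_sum_def)
  qed (auto simp: perm_op_def op_sum_def)
qed (fact assms)

text \<open>Row r of the adjoint has its only nonzero entry, a 1, in column f r, so left
  multiplication by it selects row f r of X.\<close>

lemma adjoint_perm_op_mult_index: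
  assumes f: "f \<in> {..<n} \<rightarrow> {..<n}" and X: "X \<in> carrier_mat n n" and rs: "r < n" "s < n"
  shows "(mat_adjoint (perm_op n f) * X) $$ (r, s) = X $$ (f r, s)"
proof -
  have "(mat_adjoint (perm_op n f) * X) $$ (r, s)
      = (\<Sum>k<n. mat_adjoint (perm_op n f) $$ (r, k) * X $$ (k, s))"
    by (rule times_mat_index_sum[OF mat_adjoint_carrier[OF perm_op_carrier] X rs])
  also have "\<dots> = (\<Sum>k<n. if k = f r then X $$ (k, s) else 0)"
    using f rs
    by (intro sum.cong refl) (auto simp: mat_adjoint_index[OF perm_op_carrier] perm_op_index)
  finally show ?thesis
    using f rs by auto
qed

lemma unitary_perm_op:
  assumes f: "f \<in> {..<n} \<rightarrow> {..<n}" and inj: "inj_on f {..<n}"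
  shows "mat_adjoint (perm_op n f) * perm_op n f = 1\<^sub>m n"
proof (rule eq_matI)
  fix r s assume "r < dim_row (1\<^sub>m n :: complex mat)" "s < dim_col (1\<^sub>m n :: complex mat)"
  hence rs: "r < n" "s < n" by auto
  have "perm_op n f $$ (f r, s) = (if r = s then 1 else 0)"
    using rs f inj_on_eq_iff[OF inj, of r s] by (subst perm_op_index) auto
  thus "(mat_adjoint (perm_op n f) * perm_op n f) $$ (r, s) = 1\<^sub>m n $$ (r, s)"
    using rs adjoint_perm_op_mult_index[OF f perm_op_carrier rs] by simp
qed (use mat_adjoint_carrier[OF perm_op_carrier[of n f]] in \<open>auto simp: perm_op_def\<close>)

lemma perm_op_conjugation_incoherent:
  assumes f: "f \<in> {..<n} \<rightarrow> {..<n}" and inj: "inj_on f {..<n}"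
  shows "(\<lambda>X. perm_op n f * X * mat_adjoint (perm_op n f)) \<in> incoherent_operations n"
proof -
  note adj = mat_adjoint_carrier[OF perm_op_carrier[of n f]]
  have "op_sum n (\<lambda>a. mat_adjoint (perm_op n f) * perm_op n f) {..<1::nat} = 1\<^sub>m n"
    using unitary_perm_op[OF f inj] by (subst op_sum_single) auto
  moreover have "perm_op n f * X * mat_adjoint (perm_op n f)
      = op_sum n (\<lambda>a. perm_op n f * X * mat_adjoint (perm_op n f)) {..<1::nat}"
    if "X \<in> carrier_mat n n" for X
    by (rule op_sum_single[symmetric]) (use adj that in \<open>auto intro!: mult_carrier_mat\<close>)
  ultimately show ?thesis
    using incoherent_kraus_perm_op[OF f] unfolding incoherent_operations_def
    by (intro CollectI exI[of _ 1] exI[of _ "\<lambda>_. perm_op n f"]) auto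
qed

text \<open>Conjugation relabels rows and columns by f. Evaluating at the images f r and f s avoids
  mentioning the inverse of f.\<close>

lemma perm_op_conjugation_index:
  assumes f: "f \<in> {..<n} \<rightarrow> {..<n}" and inj: "inj_on f {..<n}"
    and X: "X \<in> carrier_mat n n" and rs: "r < n" "s < n"
  shows "(perm_op n f * X * mat_adjoint (perm_op n f)) $$ (f r, f s) = X $$ (r, s)"
proof -
  let ?A = "mat_adjoint (perm_op n f)"
  note adj = mat_adjoint_carrier[OF perm_op_carrier[of n f]]
  have fr: "f r < n" "f s < n" using f rs by auto
  have PX: "(perm_op n f * X) $$ (f r, k) = X $$ (r, k)" if k: "k < n" for k
  proof -
    \<comment> \<open>Row f r of a product is row r after multiplication by the adjoint, which then
      cancels by unitarity.\<close>
    have "(perm_op n f * X) $$ (f r, k) = (?A * (perm_op n f * X)) $$ (r, k)"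
      using adjoint_perm_op_mult_index[OF f mult_carrier_mat[OF perm_op_carrier X] rs(1) k] by simp
    also have "?A * (perm_op n f * X) = X"
      using unitary_perm_op[OF f inj] X
      by (simp add: assoc_mult_mat[OF adj perm_op_carrier X, symmetric])
    finally show ?thesis .
  qed
  have "(perm_op n f * X * ?A) $$ (f r, f s) = (\<Sum>k<n. (perm_op n f * X) $$ (f r, k) * ?A $$ (k, f s))"
    by (rule times_mat_index_sum[OF mult_carrier_mat[OF perm_op_carrier X] adj fr])
  \<comment> \<open>The adjoint has entry 1 at (k, f s) exactly when f k = f s, which by injectivity
    means k = s.\<close>
  also have "\<dots> = (\<Sum>k<n. if k = s then X $$ (r, k) else 0)"
    using fr rs inj_on_eq_iff[OF inj]
    by (intro sum.cong refl) (auto simp: PX mat_adjoint_index[OF perm_op_carrier] perm_op_index)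
  finally show ?thesis using rs by simp
qed

section \<open>The swap of two systems of equal dimension\<close>

text \<open>The index of |i> \<otimes> |k> goes to that of |k> \<otimes> |i>; both factors have
  dimension D.\<close>

definition swap_index :: "nat \<Rightarrow> nat \<Rightarrow> nat" where
  "swap_index D s = (s mod D) * D + s div D"

lemma swap_index_eq: "k < D \<Longrightarrow> swap_index D (i * D + k) = k * D + i"
  by (simp add: swap_index_def)

lemma swap_index_swap_index:
  "s < D * D \<Longrightarrow> swap_index D (swap_index D s) = s"
  by (metis div_mult_mod_eq less_mult_imp_div_less swap_index_def swap_index_eq)

lemma mult_add_less: "i < m \<Longrightarrow> k < n \<Longrightarrow> i * n + k < m * (n :: nat)"
proof -
  assume "i < m" "k < n"
  hence "i * n + k < Suc i * n" by simp
  also have "\<dots> \<le> m * n" using \<open>i < m\<close> by (intro mult_right_mono) auto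
  finally show ?thesis .
qed

lemma swap_index_Pi: "swap_index D \<in> {..<D * D} \<rightarrow> {..<D * D}"
  by (cases "D = 0") (auto simp: swap_index_def less_mult_imp_div_less intro!: mult_add_less)

text \<open>The swap is an involution, hence its own left inverse.\<close>

lemma inj_on_swap_index: "inj_on (swap_index D) {..<D * D}"
  by (rule inj_on_inverseI[where g = "swap_index D"]) (simp add: swap_index_swap_index)

text \<open>Conjugation by the swap turns \<sigma> \<otimes> \<omega> into \<omega> \<otimes>
  \<sigma>, and tracing out the second factor contributes the scalar tr \<sigma>.\<close>

lemma ptrace_right_swap_kron:
  assumes \<sigma>: "\<sigma> \<in> carrier_mat D D" and \<omega>: "\<omega> \<in> carrier_mat D D"
  shows "ptrace_right D D (perm_op (D * D) (swap_index D) * kron \<sigma> \<omega>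
           * mat_adjoint (perm_op (D * D) (swap_index D))) = op_trace \<sigma> \<cdot>\<^sub>m \<omega>"
    (is "ptrace_right D D ?Y = _")
proof (rule eq_matI)
  fix i j assume "i < dim_row (op_trace \<sigma> \<cdot>\<^sub>m \<omega>)" "j < dim_col (op_trace \<sigma> \<cdot>\<^sub>m \<omega>)"
  hence ij: "i < D" "j < D" using \<omega> by auto
  have kron: "kron \<sigma> \<omega> \<in> carrier_mat (D * D) (D * D)"
    using \<sigma> \<omega> by (auto simp: kron_def)
  have "?Y $$ (i * D + k, j * D + k) = \<sigma> $$ (k, k) * \<omega> $$ (i, j)" if k: "k < D" for k
  proof -
    have lt: "k * D + i < D * D" "k * D + j < D * D"
      using ij k by (auto intro: mult_add_less)
    \<comment> \<open>The row and column indices on the left are the swap images of those on the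
      right.\<close>
    have "?Y $$ (i * D + k, j * D + k) = kron \<sigma> \<omega> $$ (k * D + i, k * D + j)"
      using perm_op_conjugation_index[OF swap_index_Pi inj_on_swap_index kron lt] ij
      by (simp add: swap_index_eq)
    thus ?thesis using \<sigma> \<omega> ij lt by (simp add: kron_def)
  qed
  thus "ptrace_right D D ?Y $$ (i, j) = (op_trace \<sigma> \<cdot>\<^sub>m \<omega>) $$ (i, j)"
    using \<sigma> \<omega> ij by (simp add: ptrace_right_def op_trace_def sum_distrib_right)
qed (use \<omega> in \<open>auto simp: ptrace_right_def\<close>)

section \<open>The maximally coherent state\<close>

text \<open>This is the projector onto the uniform superposition of all n basis vectors.\<close>

definition max_coherent :: "nat \<Rightarrow> complex mat" where
  "max_coherent n = mat n n (\<lambda>_. 1 / of_nat n)"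

lemma max_coherent_carrier: "max_coherent n \<in> carrier_mat n n"
  by (simp add: max_coherent_def)

lemma max_coherent_index: "i < n \<Longrightarrow> j < n \<Longrightarrow> max_coherent n $$ (i, j) = 1 / of_nat n"
  by (simp add: max_coherent_def)

lemma density_operator_max_coherent:
  assumes "0 < n"
  shows "density_operator n (max_coherent n)"
  unfolding density_operator_def positive_semidefinite_def
proof (intro conjI ballI)
  show "max_coherent n \<in> carrier_mat n n"
    by (rule max_coherent_carrier)
  show "mat_adjoint (max_coherent n) = max_coherent n"
    using mat_adjoint_carrier[OF max_coherent_carrier[of n]] carrier_matD[OF max_coherent_carrier[of n]]
    by (intro eq_matI) (auto simp: mat_adjoint_index[OF max_coherent_carrier] max_coherent_index)
  show "op_trace (max_coherent n) = 1"
    using assms by (simp add: op_trace_def max_coherent_def)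
next
  fix v :: "complex vec" assume v: "v \<in> carrier_vec n"
  \<comment> \<open>Every row of the matrix is constant, so each entry of its product with v is S /
    n, and the quadratic form becomes |S|^2 / n.\<close>
  define S where "S = (\<Sum>i<n. v $ i)"
  have "(max_coherent n *\<^sub>v v) $ i = S / of_nat n" if "i < n" for i
    using that v
    by (simp add: max_coherent_def scalar_prod_def S_def sum_divide_distrib lessThan_atLeast0)
  hence "(max_coherent n *\<^sub>v v) \<bullet>c v = (\<Sum>i<n. S / of_nat n * cnj (v $ i))"
    using v by (simp add: scalar_prod_def lessThan_atLeast0)
  also have "\<dots> = S * cnj S / of_nat n"
    by (simp add: sum_distrib_left[symmetric] sum_divide_distrib[symmetric] S_def)
  also have "\<dots> = of_real ((cmod S)\<^sup>2 / real n)"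
    by (simp add: complex_mult_cnj cmod_power2)
  finally show "0 \<le> (max_coherent n *\<^sub>v v) \<bullet>c v"
    by (simp add: less_eq_complex_def)
qed

text \<open>For n at least 2 there is an off-diagonal position (0, 1), and its entry 1 / n is
  nonzero.\<close>

lemma max_coherent_not_free:
  assumes "2 \<le> n"
  shows "max_coherent n \<notin> free_states n"
proof
  assume "max_coherent n \<in> free_states n"
  hence "max_coherent n $$ (0, 1) = 0"
    using assms max_coherent_carrier[of n] unfolding free_states_def diagonal_mat_def
    by fastforce
  thus False using assms by (simp add: max_coherent_index)
qed

theorem theorem4:
  fixes d N :: nat and \<epsilon> :: real
  assumes "d \<ge> 2" and "N \<ge> 1" and "0 \<le> \<epsilon>" and "\<epsilon> < 1"
  shows "\<exists>\<rho> (dC :: nat list) \<omega> \<Lambda>.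
    density_operator (d ^ N) \<rho> \<and> \<rho> \<notin> free_states (d ^ N) \<and>
    dC \<noteq> [] \<and> (\<forall>c\<in>set dC. 0 < c) \<and>
    density_operator (prod_list dC) \<omega> \<and>
    \<Lambda> \<in> incoherent_operations (d ^ N * prod_list dC) \<and>
    ptrace_right (d ^ N) (prod_list dC)
      (\<Lambda> (kron (tensor_power d (censor d \<epsilon>) N \<rho>) \<omega>)) = \<rho>"
proof -
  define D where "D = d ^ N"
  define \<rho> where "\<rho> = max_coherent D"
  define \<Lambda> where "\<Lambda> = (\<lambda>X. perm_op (D * D) (swap_index D) * X
    * mat_adjoint (perm_op (D * D) (swap_index D)))"
  \<comment> \<open>Both d \<ge> 2 and N \<ge> 1 enter here: the joint dimension must be at least 2
    for a coherent state to exist.\<close>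
  have "2 ^ 1 \<le> (2::nat) ^ N" using assms(2) by (intro power_increasing) auto
  also have "2 ^ N \<le> D" unfolding D_def using assms(1) by (rule power_mono) simp
  finally have D: "2 \<le> D" by simp
  let ?\<sigma> = "tensor_power d (censor d \<epsilon>) N \<rho>"
  have \<rho>: "density_operator D \<rho>" "\<rho> \<in> carrier_mat D D" "\<rho> \<notin> free_states D"
    using D density_operator_max_coherent[of D] max_coherent_carrier max_coherent_not_free
    by (auto simp: \<rho>_def)
  \<comment> \<open>Trace 1 makes the scalar left over from the partial trace equal to 1, so exactly
    \<rho> is recovered.\<close>
  have "?\<sigma> \<in> carrier_mat D D" "op_trace ?\<sigma> = 1"
    using trace_preserving_tensor_power[OF trace_preserving_censor, of d N \<epsilon>] \<rho>
    by (auto simp: trace_preserving_def density_operator_def D_def)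
  hence "ptrace_right D D (\<Lambda> (kron ?\<sigma> \<rho>)) = \<rho>"
    unfolding \<Lambda>_def using \<rho>(2) by (auto simp: ptrace_right_swap_kron)
  moreover have "\<Lambda> \<in> incoherent_operations (D * D)"
    unfolding \<Lambda>_def by (rule perm_op_conjugation_incoherent[OF swap_index_Pi inj_on_swap_index])
  ultimately show ?thesis
    using \<rho> assms(1) unfolding D_def
    \<comment> \<open>There is one independent party, of dimension \<open>d ^ N\<close>; the same
      \<rho> serves as the sent state and as the catalyst \<omega>.\<close>
    by (intro exI[of _ \<rho>] exI[of _ "[d ^ N]"] exI[of _ \<Lambda>]) simp
qed

end
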